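(* Let $\Omega\subset\mathbb{R}^d$ ($d=2,3$) be a bounded two-phase conducting body with scalar phase conductivities $\sigma^{(1)},\sigma^{(2)}\ge 0$, volume fractions $f^{(1)},f^{(2)}$ and breakdown thresholds $c^{(1)},c^{(2)}>0$, and let $V$ solve the source-free conductivity equations in $\Omega$, with $\mathbf{E}=-\nabla V$ and $\mathbf{J}=\sigma\mathbf{E}$. If the material has not broken down, then the average $\langle\mathbf{J}\cdot\mathbf{E}\rangle=\frac{1}{|\Omega|}\int_\Omega\mathbf{J}\cdot\mathbf{E}\,d\mathbf{x}$, which is given in terms of boundary data by $$\langle\mathbf{J}\cdot\mathbf{E}\rangle=-\frac{1}{|\Omega|}\int_{\partial\Omega}V\,(\mathbf{J}\cdot\mathbf{n})\,dS,$$ satisfies $$\langle\mathbf{J}\cdot\mathbf{E}\rangle\le\sigma^{(1)}(c^{(1)})^2f^{(1)}+\sigma^{(2)}(c^{(2)})^2f^{(2)}.$$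
   Context: Phase $\alpha$ occupies $\Omega_\alpha\subset\Omega$ with characteristic function $\chi_\alpha$, where $\chi_1+\chi_2=1$ in $\Omega$ up to measure zero, and $f^{(\alpha)}=|\Omega_\alpha|/|\Omega|$. The source-free conductivity equations are $\mathbf{J}=\sigma\mathbf{E}$, $\nabla\cdot\mathbf{J}=0$, $\mathbf{E}=-\nabla V$ with $\sigma=\sigma^{(1)}\chi_1+\sigma^{(2)}\chi_2$ (solutions in the weak sense, on a domain regular enough for the divergence theorem). $\mathbf{n}$ is the outward unit normal to $\partial\Omega$. The material has not broken down means $|\mathbf{E}(\mathbf{x})|<c^{(\alpha)}$ at (almost) every $\mathbf{x}\in\Omega_\alpha$, $\alpha=1,2$. *)

theory Defs
  imports "HOL-Analysis.Analysis"
begin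

section \<open>Hausdorff measure\<close>

text \<open>
  The normalisation is the one for which the \<open>k\<close>-dimensional measure agrees with the classical
  \<open>k\<close>-dimensional area of smooth surfaces.
\<close>

definition hausdorff_gauge :: "nat \<Rightarrow> 'a::euclidean_space set \<Rightarrow> ennreal" where
  "hausdorff_gauge k C =
    (if C = {} then 0 else ennreal (unit_ball_vol (real k) * (diameter C / 2) ^ k))"

definition hausdorff_covers :: "real \<Rightarrow> 'a::euclidean_space set \<Rightarrow> (nat \<Rightarrow> 'a set) set" where
  "hausdorff_covers \<delta> A = {C. A \<subseteq> (\<Union>i. C i) \<and> (\<forall>i. bounded (C i) \<and> diameter (C i) \<le> \<delta>)}"

definition hausdorff_premeasure :: "nat \<Rightarrow> real \<Rightarrow> 'a::euclidean_space set \<Rightarrow> ennreal" where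
  "hausdorff_premeasure k \<delta> A = (INF C\<in>hausdorff_covers \<delta> A. \<Sum>i. hausdorff_gauge k (C i))"

definition hausdorff_outer :: "nat \<Rightarrow> 'a::euclidean_space set \<Rightarrow> ennreal" where
  "hausdorff_outer k A = (SUP \<delta>\<in>{0<..}. hausdorff_premeasure k \<delta> A)"

definition hausdorff_measure :: "nat \<Rightarrow> 'a::euclidean_space measure" where
  "hausdorff_measure k = measure_of UNIV (sets borel) (hausdorff_outer k)"

text \<open>
  \<^const>\<open>measure_of\<close> yields the zero measure unless its argument is countably additive, so we prove
  Caratheodory's criterion and conclude in \<open>emeasure_hausdorff_measure\<close> that
  \<^const>\<open>hausdorff_measure\<close> really takes the values of \<^const>\<open>hausdorff_outer\<close> on Borel sets.
\<close>

lemma hausdorff_premeasure_empty: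
  "\<delta> > 0 \<Longrightarrow> hausdorff_premeasure k \<delta> ({} :: 'a::euclidean_space set) = 0"
proof -
  assume "\<delta> > 0"
  then have "(\<lambda>_. {}) \<in> hausdorff_covers \<delta> ({} :: 'a set)" by (auto simp: hausdorff_covers_def)
  then have "hausdorff_premeasure k \<delta> ({} :: 'a set) \<le> (\<Sum>i::nat. hausdorff_gauge k ({}::'a set))"
    unfolding hausdorff_premeasure_def by (rule INF_lower2) simp
  then show ?thesis by (simp add: hausdorff_gauge_def)
qed

lemma hausdorff_premeasure_mono:
  "A \<subseteq> B \<Longrightarrow> \<delta>' \<le> \<delta> \<Longrightarrow> hausdorff_premeasure k \<delta> A \<le> hausdorff_premeasure k \<delta>' B"
  unfolding hausdorff_premeasure_def
  by (rule INF_superset_mono) (auto simp: hausdorff_covers_def intro: order_trans)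

lemma hausdorff_premeasure_countable_UN:
  "hausdorff_premeasure k \<delta> (\<Union>n. A n) \<le> (\<Sum>n. hausdorff_premeasure k \<delta> (A n))"
proof (cases "(\<Sum>n. hausdorff_premeasure k \<delta> (A n)) = \<infinity>")
  case False
  show ?thesis
  proof (rule ennreal_le_epsilon)
    fix e :: real assume e: "0 < e"
    have fin: "hausdorff_premeasure k \<delta> (A n) < \<infinity>" for n
      using False by (metis ennreal_suminf_lessD infinity_ennreal_def less_top)
    have "\<exists>C. C \<in> hausdorff_covers \<delta> (A n) \<and>
        (\<Sum>i. hausdorff_gauge k (C i)) \<le> hausdorff_premeasure k \<delta> (A n) + ennreal (e * (1/2)^Suc n)" for n
    proof -
      have "hausdorff_premeasure k \<delta> (A n) < hausdorff_premeasure k \<delta> (A n) + ennreal (e * (1/2)^Suc n)"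
        using fin[of n] e by (simp add: ennreal_less_iff less_top)
      then show ?thesis
        unfolding hausdorff_premeasure_def[of k \<delta> "A n"] INF_less_iff by (meson less_imp_le)
    qed
    then obtain C where C: "\<And>n. C n \<in> hausdorff_covers \<delta> (A n)"
      and le: "\<And>n. (\<Sum>i. hausdorff_gauge k (C n i)) \<le> hausdorff_premeasure k \<delta> (A n) + ennreal (e * (1/2)^Suc n)"
      by metis
    define D where "D = (\<lambda>m. case prod_decode m of (n, i) \<Rightarrow> C n i)"
    have "D \<in> hausdorff_covers \<delta> (\<Union>n. A n)"
    proof -
      have "x \<in> (\<Union>m. D m)" if x: "x \<in> A n" for x n
      proof -
        obtain i where "x \<in> C n i" using C[of n] x by (auto simp: hausdorff_covers_def)
        then have "x \<in> D (prod_encode (n, i))" by (simp add: D_def)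
        then show ?thesis by blast
      qed
      moreover have "bounded (D m) \<and> diameter (D m) \<le> \<delta>" for m
        using C by (auto simp: D_def hausdorff_covers_def split: prod.split)
      ultimately show ?thesis by (auto simp: hausdorff_covers_def)
    qed
    then have "hausdorff_premeasure k \<delta> (\<Union>n. A n) \<le> (\<Sum>m. hausdorff_gauge k (D m))"
      unfolding hausdorff_premeasure_def by (rule INF_lower)
    also have "\<dots> = (\<Sum>n. \<Sum>i. hausdorff_gauge k (C n i))"
      using suminf_ennreal_2dimen[of "\<lambda>n. \<Sum>i. hausdorff_gauge k (C n i)" "\<lambda>(n, i). hausdorff_gauge k (C n i)"]
      by (simp add: D_def comp_def case_prod_beta)
    also have "\<dots> \<le> (\<Sum>n. hausdorff_premeasure k \<delta> (A n) + ennreal (e * (1/2)^Suc n))"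
      by (intro suminf_le le) auto
    also have "\<dots> = (\<Sum>n. hausdorff_premeasure k \<delta> (A n)) + (\<Sum>n. ennreal (e * (1/2)^Suc n))"
      by (subst suminf_add) auto
    also have "(\<Sum>n. ennreal (e * (1/2)^Suc n)) = ennreal e"
    proof -
      have "(\<lambda>n. e * (1/2)^Suc n) sums (e * 1)"
        by (intro sums_mult power_half_series)
      then show ?thesis
        using e by (intro suminf_ennreal_eq) auto
    qed
    finally show "hausdorff_premeasure k \<delta> (\<Union>n. A n)
        \<le> (\<Sum>n. hausdorff_premeasure k \<delta> (A n)) + ennreal e" .
  qed
qed simp

lemma hausdorff_outer_empty: "hausdorff_outer k {} = 0"
  unfolding hausdorff_outer_def
  by (rule antisym) (auto intro!: SUP_least simp: hausdorff_premeasure_empty)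

lemma hausdorff_outer_mono: "A \<subseteq> B \<Longrightarrow> hausdorff_outer k A \<le> hausdorff_outer k B"
  unfolding hausdorff_outer_def by (rule SUP_mono) (auto intro: hausdorff_premeasure_mono)

lemma hausdorff_outer_countable_UN:
  "hausdorff_outer k (\<Union>n. A n) \<le> (\<Sum>n. hausdorff_outer k (A n))"
  unfolding hausdorff_outer_def[of k "\<Union>n. A n"]
proof (rule SUP_least)
  fix \<delta> :: real assume d: "\<delta> \<in> {0<..}"
  have "hausdorff_premeasure k \<delta> (\<Union>n. A n) \<le> (\<Sum>n. hausdorff_premeasure k \<delta> (A n))"
    by (rule hausdorff_premeasure_countable_UN)
  also have "\<dots> \<le> (\<Sum>n. hausdorff_outer k (A n))"
    unfolding hausdorff_outer_def by (intro suminf_le SUP_upper d) auto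
  finally show "hausdorff_premeasure k \<delta> (\<Union>n. A n) \<le> (\<Sum>n. hausdorff_outer k (A n))" .
qed

lemma hausdorff_outer_Un: "hausdorff_outer k (A \<union> B) \<le> hausdorff_outer k A + hausdorff_outer k B"
proof -
  have "hausdorff_outer k (A \<union> B) = hausdorff_outer k (\<Union>n. binaryset A B n)"
    by (simp add: UN_binaryset_eq)
  also have "\<dots> \<le> (\<Sum>n. hausdorff_outer k (binaryset A B n))"
    by (rule hausdorff_outer_countable_UN)
  also have "\<dots> = hausdorff_outer k A + hausdorff_outer k B"
    by (simp add: suminf_binaryset_eq hausdorff_outer_empty)
  finally show ?thesis .
qed

lemma hausdorff_outer_separated:
  assumes r: "r > 0" and sep: "\<And>x y. x \<in> A \<Longrightarrow> y \<in> B \<Longrightarrow> r \<le> dist x y"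
  shows "hausdorff_outer k A + hausdorff_outer k B \<le> hausdorff_outer k (A \<union> B)"
proof -
  have key: "hausdorff_premeasure k \<delta> A + hausdorff_premeasure k \<delta> B \<le> hausdorff_premeasure k \<delta> (A \<union> B)"
    if d: "\<delta> < r" for \<delta>
    unfolding hausdorff_premeasure_def[of k \<delta> "A \<union> B"]
  proof (rule INF_greatest)
    fix C assume C: "C \<in> hausdorff_covers \<delta> (A \<union> B)"
    define P where "P = (\<lambda>i. if C i \<inter> A = {} then {} else C i)"
    define Q where "Q = (\<lambda>i. if C i \<inter> A = {} then C i else {})"
    have bd: "bounded (C i)" "diameter (C i) \<le> \<delta>" for i
      using C by (auto simp: hausdorff_covers_def)
    have d0: "0 \<le> \<delta>" using bd[of 0] diameter_ge_0[of "C 0"] by linarith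
    have "P \<in> hausdorff_covers \<delta> A"
      using C d0 by (fastforce simp: hausdorff_covers_def P_def)
    then have 1: "hausdorff_premeasure k \<delta> A \<le> (\<Sum>i. hausdorff_gauge k (P i))"
      unfolding hausdorff_premeasure_def by (rule INF_lower)
    have no: "y \<notin> B" if "x \<in> C i" "x \<in> A" "y \<in> C i" for x y i
      using diameter_bounded_bound[OF bd(1) that(1,3)] bd(2)[of i] sep[OF that(2), of y] d by fastforce
    have "B \<subseteq> (\<Union>i. Q i)"
    proof
      fix y assume y: "y \<in> B"
      then obtain i where "y \<in> C i" using C by (auto simp: hausdorff_covers_def)
      with no y have "C i \<inter> A = {}" by blast
      with \<open>y \<in> C i\<close> show "y \<in> (\<Union>i. Q i)" by (auto simp: Q_def)
    qed
    then have "Q \<in> hausdorff_covers \<delta> B"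
      using bd d0 by (auto simp: hausdorff_covers_def Q_def)
    then have 2: "hausdorff_premeasure k \<delta> B \<le> (\<Sum>i. hausdorff_gauge k (Q i))"
      unfolding hausdorff_premeasure_def by (rule INF_lower)
    have "(\<Sum>i. hausdorff_gauge k (P i)) + (\<Sum>i. hausdorff_gauge k (Q i))
        = (\<Sum>i. hausdorff_gauge k (P i) + hausdorff_gauge k (Q i))"
      by (subst suminf_add) auto
    also have "\<dots> = (\<Sum>i. hausdorff_gauge k (C i))"
      by (intro arg_cong[of _ _ suminf] ext) (auto simp: P_def Q_def hausdorff_gauge_def)
    finally show "hausdorff_premeasure k \<delta> A + hausdorff_premeasure k \<delta> B \<le> (\<Sum>i. hausdorff_gauge k (C i))"
      using add_mono[OF 1 2] by simp
  qed
  have "hausdorff_premeasure k a A + hausdorff_premeasure k b B \<le> hausdorff_outer k (A \<union> B)"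
    if "a > 0" "b > 0" for a b
  proof -
    define m where "m = min (min a b) (r/2)"
    have m: "m > 0" "m < r" "m \<le> a" "m \<le> b" using that r by (auto simp: m_def)
    have "hausdorff_premeasure k a A + hausdorff_premeasure k b B
        \<le> hausdorff_premeasure k m A + hausdorff_premeasure k m B"
      using m by (intro add_mono hausdorff_premeasure_mono) auto
    also have "\<dots> \<le> hausdorff_premeasure k m (A \<union> B)" by (rule key[OF m(2)])
    also have "\<dots> \<le> hausdorff_outer k (A \<union> B)"
      unfolding hausdorff_outer_def using m by (intro SUP_upper) auto
    finally show ?thesis .
  qed
  then have "hausdorff_outer k A + hausdorff_premeasure k b B \<le> hausdorff_outer k (A \<union> B)" if "b > 0" for b
    unfolding hausdorff_outer_def[of k A] using that
    by (subst ennreal_SUP_add_left[symmetric]) (auto intro!: SUP_least)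
  then show ?thesis
    unfolding hausdorff_outer_def[of k B]
    by (subst ennreal_SUP_add_right) (auto intro!: SUP_least)
qed

lemma hausdorff_outer_caratheodory:
  assumes F: "closed F"
  shows "hausdorff_outer k (A \<inter> F) + hausdorff_outer k (A - F) \<le> hausdorff_outer k A"
proof (cases "F = {} \<or> hausdorff_outer k A = \<infinity>")
  case True
  then show ?thesis by (auto simp: hausdorff_outer_empty)
next
  case False
  then have F0: "F \<noteq> {}" and fin: "hausdorff_outer k A < \<infinity>" by (auto simp: less_top)
  let ?H = "hausdorff_outer k"
  define B where "B = (\<lambda>n. {x \<in> A. 1 / real (Suc n) \<le> infdist x F})"
  define R where "R = (\<lambda>n. B (Suc n) - B n)"
  have lip: "infdist x F \<le> infdist y F + dist x y" for x y
    by (rule infdist_triangle)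
  have B_F: "?H (A \<inter> F) + ?H (B n) \<le> ?H A" for n
  proof -
    have "?H (A \<inter> F) + ?H (B n) \<le> ?H (A \<inter> F \<union> B n)"
    proof (rule hausdorff_outer_separated)
      show "1 / real (Suc n) \<le> dist x y" if "x \<in> A \<inter> F" "y \<in> B n" for x y
        using that lip[of y x] by (auto simp: B_def dist_commute)
    qed simp
    also have "\<dots> \<le> ?H A" by (rule hausdorff_outer_mono) (auto simp: B_def)
    finally show ?thesis .
  qed
  have odd_even: "(\<Sum>i<m. ?H (R (2*i+p))) \<le> ?H (\<Union>i<m. R (2*i+p))" for m p
  proof (induction m)
    case (Suc m)
    have "(\<Sum>i<Suc m. ?H (R (2*i+p))) \<le> ?H (\<Union>i<m. R (2*i+p)) + ?H (R (2*m+p))"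
      using Suc by (simp add: add_right_mono)
    also have "\<dots> \<le> ?H ((\<Union>i<m. R (2*i+p)) \<union> R (2*m+p))"
    proof (cases "m = 0")
      case False
      show ?thesis
      proof (rule hausdorff_outer_separated)
      show "0 < 1 / real (2*m+p) - 1 / real (2*m+p+1)"
        using False by (simp add: frac_less2)
    next
      fix x y assume "x \<in> (\<Union>i<m. R (2*i+p))" and y: "y \<in> R (2*m+p)"
      then obtain i where i: "i < m" "x \<in> R (2*i+p)" by auto
      then have m0: "m > 0" by simp
      have "1 / real (2*m+p) \<le> 1 / real (Suc (Suc (2*i+p)))"
        using i by (intro divide_left_mono) auto
      also have "\<dots> \<le> infdist x F" using i by (auto simp: R_def B_def)
      finally have "1 / real (2*m+p) \<le> infdist x F" .
      moreover have "infdist y F < 1 / real (2*m+p+1)"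
        using y by (auto simp: R_def B_def not_le)
      ultimately show "1 / real (2*m+p) - 1 / real (2*m+p+1) \<le> dist x y"
        using lip[of x y] by linarith
      qed
    qed (simp add: hausdorff_outer_empty)
    also have "(\<Union>i<m. R (2*i+p)) \<union> R (2*m+p) = (\<Union>i<Suc m. R (2*i+p))"
      by (auto simp: less_Suc_eq)
    finally show ?case .
  qed (simp add: hausdorff_outer_empty)
  have R_A: "(\<Sum>i<m. ?H (R (2*i+p))) \<le> ?H A" for m p
    by (rule order_trans[OF odd_even hausdorff_outer_mono]) (auto simp: R_def B_def)
  have "(\<Sum>i. ?H (R i)) \<le> 2 * ?H A"
  proof (rule suminf_le_const)
    fix n
    have split: "(\<Sum>i<2*m. ?H (R i)) = (\<Sum>i<m. ?H (R (2*i+0))) + (\<Sum>i<m. ?H (R (2*i+1)))" for m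
      by (induction m) (auto simp: algebra_simps)
    have "(\<Sum>i<n. ?H (R i)) \<le> (\<Sum>i<2*n. ?H (R i))" by (rule sum_mono2) auto
    also have "\<dots> \<le> ?H A + ?H A"
      unfolding split by (intro add_mono R_A)
    also have "\<dots> = 2 * ?H A" by (rule mult_2[symmetric])
    finally show "(\<Sum>i<n. ?H (R i)) \<le> 2 * ?H A" .
  qed auto
  also have "\<dots> < \<infinity>" using fin by (simp add: ennreal_mult_less_top)
  finally have T: "(\<Sum>i. ?H (R i)) < \<infinity>" .
  have tail: "?H (A - F) \<le> ?H (B n) + (\<Sum>i. ?H (R (i + n)))" for n
  proof -
    have "A - F \<subseteq> B n \<union> (\<Union>i. R (i + n))"
    proof
      fix x assume x: "x \<in> A - F"
      then have "infdist x F > 0"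
        using F F0 in_closed_iff_infdist_zero infdist_nonneg[of x F] by (metis DiffD2 less_eq_real_def)
      then obtain N where "inverse (real (Suc N)) < infdist x F" using reals_Archimedean by blast
      then have N: "x \<in> B N" using x by (auto simp: B_def inverse_eq_divide)
      define l where "l = (LEAST j. x \<in> B j)"
      have l: "x \<in> B l" unfolding l_def using N by (rule LeastI)
      have nl: "x \<notin> B j" if "j < l" for j using that not_less_Least unfolding l_def by blast
      show "x \<in> B n \<union> (\<Union>i. R (i + n))"
      proof (cases "l \<le> n")
        case True
        then have "1 / real (Suc n) \<le> 1 / real (Suc l)" by (intro divide_left_mono) auto
        then show ?thesis using l by (auto simp: B_def)
      next
        case False
        then have "x \<in> R (l - 1)" using l nl[of "l - 1"] by (auto simp: R_def)
        moreover have "l - 1 = (l - 1 - n) + n" using False by simp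
        ultimately show ?thesis by (metis UNIV_I UN_I UnI2)
      qed
    qed
    then have "?H (A - F) \<le> ?H (B n \<union> (\<Union>i. R (i + n)))" by (rule hausdorff_outer_mono)
    also have "\<dots> \<le> ?H (B n) + ?H (\<Union>i. R (i + n))" by (rule hausdorff_outer_Un)
    also have "\<dots> \<le> ?H (B n) + (\<Sum>i. ?H (R (i + n)))"
      by (intro add_left_mono hausdorff_outer_countable_UN)
    finally show ?thesis .
  qed
  have "(\<Sum>i. ?H (R i)) + (?H (A \<inter> F) + ?H (A - F)) \<le> ?H A + (\<Sum>i. ?H (R i))"
  proof (rule ennreal_suminf_bound_add)
    show "\<And>n. (\<Sum>i<n. ?H (R i)) + (?H (A \<inter> F) + ?H (A - F)) \<le> ?H A + (\<Sum>i. ?H (R i))"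
    proof -
      fix n
      have "(\<Sum>i<n. ?H (R i)) + (?H (A \<inter> F) + ?H (A - F))
          \<le> (\<Sum>i<n. ?H (R i)) + (?H (A \<inter> F) + (?H (B n) + (\<Sum>i. ?H (R (i + n)))))"
        by (intro add_left_mono tail)
      also have "\<dots> = (?H (A \<inter> F) + ?H (B n)) + ((\<Sum>i. ?H (R (i + n))) + (\<Sum>i<n. ?H (R i)))"
        by (simp add: ac_simps)
      also have "(\<Sum>i. ?H (R (i + n))) + (\<Sum>i<n. ?H (R i)) = (\<Sum>i. ?H (R i))"
        by (subst suminf_offset[of "\<lambda>i. ?H (R i)" n]) (auto simp: add.commute)
      also have "?H (A \<inter> F) + ?H (B n) + (\<Sum>i. ?H (R i)) \<le> ?H A + (\<Sum>i. ?H (R i))"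
        by (intro add_right_mono B_F)
      finally show "(\<Sum>i<n. ?H (R i)) + (?H (A \<inter> F) + ?H (A - F)) \<le> ?H A + (\<Sum>i. ?H (R i))" .
    qed
  qed
  then show ?thesis
    using less_imp_neq[OF T]
    by (simp add: add.commute[of _ "\<Sum>i. ?H (R i)"] ennreal_add_left_cancel_le)
qed

lemma emeasure_hausdorff_measure:
  assumes "A \<in> sets borel"
  shows "emeasure (hausdorff_measure k) A = hausdorff_outer k A"
proof -
  interpret P: sigma_algebra UNIV "Pow UNIV :: 'a set set" by (rule sigma_algebra_Pow)
  let ?L = "lambda_system UNIV (Pow UNIV) (hausdorff_outer k :: 'a set \<Rightarrow> ennreal)"
  have oms: "outer_measure_space (Pow UNIV) (hausdorff_outer k :: 'a set \<Rightarrow> ennreal)"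
    by (auto simp: outer_measure_space_def positive_def increasing_def countably_subadditive_def
        hausdorff_outer_empty hausdorff_outer_mono hausdorff_outer_countable_UN)
  have ms: "measure_space UNIV ?L (hausdorff_outer k)"
    by (rule P.caratheodory_lemma[OF oms])
  then interpret L: sigma_algebra UNIV ?L by (simp add: measure_space_def)
  have closedL: "F \<in> ?L" if "closed F" for F :: "'a set"
  proof -
    have "hausdorff_outer k A \<le> hausdorff_outer k (A \<inter> F) + hausdorff_outer k (A - F)" for A
      using hausdorff_outer_Un[of k "A \<inter> F" "A - F"] by (simp add: Int_Diff_Un)
    then show ?thesis
      unfolding P.lambda_system_eq
      using hausdorff_outer_caratheodory[OF that, of k] by (auto intro: antisym)
  qed
  have "sets borel = sigma_sets UNIV (Collect closed :: 'a set set)"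
    by (simp add: borel_eq_closed)
  also have "\<dots> \<subseteq> ?L" using closedL by (intro L.sigma_sets_subset) auto
  finally have sub: "sets borel \<subseteq> ?L" .
  have "measure_space UNIV (sets borel) (hausdorff_outer k :: 'a set \<Rightarrow> ennreal)"
    using sets.sigma_algebra_axioms[of "borel :: 'a measure"]
    by (intro measure_down[OF ms _ sub]) simp
  then show ?thesis
    unfolding hausdorff_measure_def using assms
    by (intro emeasure_measure_of_sigma) (auto simp: measure_space_def)
qed

lemma sets_hausdorff_measure [simp, measurable_cong]: "sets (hausdorff_measure k) = sets borel"
  using sets.sets_measure_of_eq[of borel] by (simp add: hausdorff_measure_def)

lemma space_hausdorff_measure [simp]: "space (hausdorff_measure k) = UNIV"
  unfolding hausdorff_measure_def by (simp add: space_measure_of_conv)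


section \<open>Smooth functions and divergence-theorem domains\<close>

definition grad :: "('a::euclidean_space \<Rightarrow> real) \<Rightarrow> 'a \<Rightarrow> 'a" where
  "grad f x = (\<Sum>b\<in>Basis. frechet_derivative f (at x) b *\<^sub>R b)"

definition divergence :: "('a::euclidean_space \<Rightarrow> 'a) \<Rightarrow> 'a \<Rightarrow> real" where
  "divergence F x = (\<Sum>b\<in>Basis. grad (\<lambda>y. F y \<bullet> b) x \<bullet> b)"

definition C1 :: "('a::euclidean_space \<Rightarrow> real) \<Rightarrow> bool" where
  "C1 f \<longleftrightarrow> (\<forall>x. f differentiable (at x)) \<and> continuous_on UNIV (grad f)"

definition C1_field :: "('a::euclidean_space \<Rightarrow> 'a) \<Rightarrow> bool" where
  "C1_field F \<longleftrightarrow> (\<forall>b\<in>Basis. C1 (\<lambda>x. F x \<bullet> b))"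

definition test_function :: "'a::euclidean_space set \<Rightarrow> ('a \<Rightarrow> real) \<Rightarrow> bool" where
  "test_function \<Omega> \<phi> \<longleftrightarrow> C1 \<phi> \<and> (\<exists>K. compact K \<and> K \<subseteq> \<Omega> \<and> (\<forall>x. x \<notin> K \<longrightarrow> \<phi> x = 0))"

definition surface_measure :: "'a::euclidean_space set \<Rightarrow> 'a measure" where
  "surface_measure \<Omega> = restrict_space (hausdorff_measure (DIM('a) - 1)) (frontier \<Omega>)"

text \<open>
  The outward unit normal in Federer's sense: near \<open>x\<close>, up to density zero, \<open>\<Omega>\<close> is the half space
  of points \<open>y\<close> with \<open>(y - x) \<bullet> n < 0\<close>. Where the boundary is \<open>C\<^sup>1\<close> this is the classical normal.
\<close>

definition outward_unit_normal :: "'a::euclidean_space set \<Rightarrow> 'a \<Rightarrow> 'a \<Rightarrow> bool" where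
  "outward_unit_normal \<Omega> x n \<longleftrightarrow> norm n = 1 \<and>
    ((\<lambda>r. measure lebesgue {y \<in> ball x r. y \<in> \<Omega> \<and> (y - x) \<bullet> n > 0} / r ^ DIM('a))
       \<longlongrightarrow> 0) (at_right 0) \<and>
    ((\<lambda>r. measure lebesgue {y \<in> ball x r. y \<notin> \<Omega> \<and> (y - x) \<bullet> n < 0} / r ^ DIM('a))
       \<longlongrightarrow> 0) (at_right 0)"

text \<open>
  Bounded open sets regular enough for the divergence theorem to hold with outward unit normal
  \<open>\<nu>\<close>; every bounded Lipschitz domain is one.
\<close>

definition divergence_theorem_domain :: "'a::euclidean_space set \<Rightarrow> ('a \<Rightarrow> 'a) \<Rightarrow> bool" where
  "divergence_theorem_domain \<Omega> \<nu> \<longleftrightarrow>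
    open \<Omega> \<and> bounded \<Omega> \<and> \<Omega> \<noteq> {} \<and>
    finite_measure (surface_measure \<Omega>) \<and>
    \<nu> \<in> borel_measurable (surface_measure \<Omega>) \<and>
    (AE x in surface_measure \<Omega>. outward_unit_normal \<Omega> x (\<nu> x)) \<and>
    (\<forall>F. C1_field F \<longrightarrow>
      (LINT x|lebesgue_on \<Omega>. divergence F x) = (LINT x|surface_measure \<Omega>. F x \<bullet> \<nu> x))"

section \<open>Weak solutions and their boundary data\<close>

definition L2 :: "'a measure \<Rightarrow> ('a \<Rightarrow> 'b::euclidean_space) \<Rightarrow> bool" where
  "L2 M f \<longleftrightarrow> f \<in> borel_measurable M \<and> integrable M (\<lambda>x. (norm (f x))\<^sup>2)"

definition weak_gradient :: "'a::euclidean_space set \<Rightarrow> ('a \<Rightarrow> real) \<Rightarrow> ('a \<Rightarrow> 'a) \<Rightarrow> bool" where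
  "weak_gradient \<Omega> V G \<longleftrightarrow>
    (\<forall>\<phi>. test_function \<Omega> \<phi> \<longrightarrow> (\<forall>b\<in>Basis.
      (LINT x|lebesgue_on \<Omega>. V x * (grad \<phi> x \<bullet> b)) = - (LINT x|lebesgue_on \<Omega>. (G x \<bullet> b) * \<phi> x)))"

definition H1_function :: "'a::euclidean_space set \<Rightarrow> ('a \<Rightarrow> real) \<Rightarrow> ('a \<Rightarrow> 'a) \<Rightarrow> bool" where
  "H1_function \<Omega> V G \<longleftrightarrow> L2 (lebesgue_on \<Omega>) V \<and> L2 (lebesgue_on \<Omega>) G \<and> weak_gradient \<Omega> V G"

definition weakly_divergence_free :: "'a::euclidean_space set \<Rightarrow> ('a \<Rightarrow> 'a) \<Rightarrow> bool" where
  "weakly_divergence_free \<Omega> J \<longleftrightarrow>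
    (\<forall>\<phi>. test_function \<Omega> \<phi> \<longrightarrow> (LINT x|lebesgue_on \<Omega>. J x \<bullet> grad \<phi> x) = 0)"

text \<open>
  \<open>u\<close> is the boundary value (trace) of the Sobolev function \<open>V\<close> with weak gradient \<open>G\<close>: the limit
  in the surface \<open>L\<^sup>2\<close> norm of the boundary values of functions that are \<open>C\<^sup>1\<close> up to the boundary and
  converge to \<open>V\<close> in \<open>H\<^sup>1\<close>.
\<close>

definition boundary_trace ::
    "'a::euclidean_space set \<Rightarrow> ('a \<Rightarrow> real) \<Rightarrow> ('a \<Rightarrow> 'a) \<Rightarrow> ('a \<Rightarrow> real) \<Rightarrow> bool" where
  "boundary_trace \<Omega> V G u \<longleftrightarrow>
    H1_function \<Omega> V G \<and> L2 (surface_measure \<Omega>) u \<and>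
    (\<exists>\<phi> :: nat \<Rightarrow> 'a \<Rightarrow> real. (\<forall>k. C1 (\<phi> k)) \<and>
      (\<lambda>k. LINT x|lebesgue_on \<Omega>. (\<phi> k x - V x)\<^sup>2) \<longlonglongrightarrow> 0 \<and>
      (\<lambda>k. LINT x|lebesgue_on \<Omega>. (norm (grad (\<phi> k) x - G x))\<^sup>2) \<longlonglongrightarrow> 0 \<and>
      (\<lambda>k. LINT x|surface_measure \<Omega>. (\<phi> k x - u x)\<^sup>2) \<longlonglongrightarrow> 0)"

text \<open>
  \<open>g\<close> is the normal component \<open>J \<bullet> n\<close> on the boundary of a weakly divergence-free field \<open>J\<close>. As \<open>J\<close>
  is determined only almost everywhere, it is again a limit in the surface \<open>L\<^sup>2\<close> norm: of the
  classical normal components of fields that are \<open>C\<^sup>1\<close> up to the boundary and converge to \<open>J\<close> in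
  the graph norm of the divergence.
\<close>

definition normal_trace ::
    "'a::euclidean_space set \<Rightarrow> ('a \<Rightarrow> 'a) \<Rightarrow> ('a \<Rightarrow> 'a) \<Rightarrow> ('a \<Rightarrow> real) \<Rightarrow> bool" where
  "normal_trace \<Omega> \<nu> J g \<longleftrightarrow>
    L2 (lebesgue_on \<Omega>) J \<and> weakly_divergence_free \<Omega> J \<and> L2 (surface_measure \<Omega>) g \<and>
    (\<exists>F :: nat \<Rightarrow> 'a \<Rightarrow> 'a. (\<forall>k. C1_field (F k)) \<and>
      (\<lambda>k. LINT x|lebesgue_on \<Omega>. (norm (F k x - J x))\<^sup>2) \<longlonglongrightarrow> 0 \<and>
      (\<lambda>k. LINT x|lebesgue_on \<Omega>. (divergence (F k) x)\<^sup>2) \<longlonglongrightarrow> 0 \<and>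
      (\<lambda>k. LINT x|surface_measure \<Omega>. (F k x \<bullet> \<nu> x - g x)\<^sup>2) \<longlonglongrightarrow> 0)"

definition conductivity_solution ::
    "'a::euclidean_space set \<Rightarrow> ('a \<Rightarrow> real) \<Rightarrow> ('a \<Rightarrow> real) \<Rightarrow> ('a \<Rightarrow> 'a) \<Rightarrow> ('a \<Rightarrow> 'a) \<Rightarrow> bool" where
  "conductivity_solution \<Omega> \<sigma> V E J \<longleftrightarrow>
    H1_function \<Omega> V (\<lambda>x. - E x) \<and>
    L2 (lebesgue_on \<Omega>) J \<and>
    (AE x in lebesgue_on \<Omega>. J x = \<sigma> x *\<^sub>R E x) \<and>
    weakly_divergence_free \<Omega> J"

section \<open>Two-phase bodies\<close>

definition two_phase_body :: "'a::euclidean_space set \<Rightarrow> 'a set \<Rightarrow> 'a set \<Rightarrow> bool" where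
  "two_phase_body \<Omega> \<Omega>1 \<Omega>2 \<longleftrightarrow>
    \<Omega>1 \<in> sets lebesgue \<and> \<Omega>2 \<in> sets lebesgue \<and> \<Omega>1 \<subseteq> \<Omega> \<and> \<Omega>2 \<subseteq> \<Omega> \<and>
    (AE x in lebesgue_on \<Omega>. indicator \<Omega>1 x + indicator \<Omega>2 x = (1::real))"

definition two_phase_conductivity ::
    "'a set \<Rightarrow> 'a set \<Rightarrow> real \<Rightarrow> real \<Rightarrow> 'a::euclidean_space \<Rightarrow> real" where
  "two_phase_conductivity \<Omega>1 \<Omega>2 \<sigma>1 \<sigma>2 x = \<sigma>1 * indicator \<Omega>1 x + \<sigma>2 * indicator \<Omega>2 x"

definition volume_fraction :: "'a::euclidean_space set \<Rightarrow> 'a set \<Rightarrow> real" where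
  "volume_fraction \<Omega> A = measure lebesgue A / measure lebesgue \<Omega>"

definition volume_average :: "'a::euclidean_space set \<Rightarrow> ('a \<Rightarrow> real) \<Rightarrow> real" where
  "volume_average \<Omega> f = 1 / measure lebesgue \<Omega> * (LINT x|lebesgue_on \<Omega>. f x)"

definition not_broken_down :: "'a::euclidean_space set \<Rightarrow> real \<Rightarrow> ('a \<Rightarrow> 'a) \<Rightarrow> bool" where
  "not_broken_down A c E \<longleftrightarrow> (AE x in lebesgue_on A. norm (E x) < c)"

section \<open>Agreement with the classical boundary data\<close>

text \<open>
  For continuously differentiable \<open>V\<close> and \<open>J\<close> the weak boundary data are the classical ones:
  \<open>boundary_trace_C1\<close> and \<open>normal_trace_C1\<close>.
\<close>

lemma C1_has_derivative:
  assumes "C1 f"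
  shows "(f has_derivative (\<lambda>h. grad f x \<bullet> h)) (at x)"
proof -
  have d: "f differentiable (at x)" using assms by (simp add: C1_def)
  then have lin: "linear (frechet_derivative f (at x))" by (rule linear_frechet_derivative)
  have "frechet_derivative f (at x) h = grad f x \<bullet> h" for h
  proof -
    have "frechet_derivative f (at x) h
        = frechet_derivative f (at x) (\<Sum>b\<in>Basis. (h \<bullet> b) *\<^sub>R b)"
      by (simp add: euclidean_representation)
    also have "\<dots> = (\<Sum>b\<in>Basis. (h \<bullet> b) * frechet_derivative f (at x) b)"
      using lin by (simp add: linear_sum linear_scale)
    also have "\<dots> = grad f x \<bullet> h"
      unfolding grad_def inner_sum_left inner_scaleR_left
      by (intro sum.cong refl) (simp add: inner_commute)
    finally show ?thesis .
  qed
  then have "frechet_derivative f (at x) = (\<lambda>h. grad f x \<bullet> h)" by auto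
  then show ?thesis using d frechet_derivative_works by metis
qed

lemma grad_eqI:
  assumes "(f has_derivative (\<lambda>h. g \<bullet> h)) (at x)"
  shows "grad f x = g"
proof -
  have "frechet_derivative f (at x) = (\<lambda>h. g \<bullet> h)"
    using assms frechet_derivative_at by metis
  then show ?thesis unfolding grad_def by (simp add: euclidean_representation)
qed

lemma C1_continuous: "C1 f \<Longrightarrow> continuous_on A f"
  by (intro continuous_at_imp_continuous_on ballI has_derivative_continuous[OF C1_has_derivative])

lemma C1_mult_grad:
  assumes "C1 f" "C1 g"
  shows "grad (\<lambda>x. f x * g x) x = f x *\<^sub>R grad g x + g x *\<^sub>R grad f x"
  by (rule grad_eqI)
    (auto intro!: derivative_eq_intros C1_has_derivative assms simp: algebra_simps inner_add_left)

lemma C1_mult: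
  assumes "C1 f" "C1 g"
  shows "C1 (\<lambda>x. f x * g x)"
proof -
  have "continuous_on UNIV (\<lambda>x. f x *\<^sub>R grad g x + g x *\<^sub>R grad f x)"
    using assms by (intro continuous_intros C1_continuous) (auto simp: C1_def)
  then show ?thesis
    using assms by (auto simp: C1_def C1_mult_grad[OF assms] intro!: differentiable_mult)
qed

lemma C1_field_continuous: "C1_field F \<Longrightarrow> continuous_on A F"
  unfolding C1_field_def
  by (subst continuous_on_componentwise) (auto intro: C1_continuous)

lemma borel_measurable_surface:
  fixes f :: "'a::euclidean_space \<Rightarrow> 'b::topological_space"
  assumes "continuous_on UNIV f" shows "f \<in> borel_measurable (surface_measure \<Omega>)"
proof -
  have "f \<in> borel_measurable (hausdorff_measure k)" for k
    using borel_measurable_continuous_onI[OF assms]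
    by (subst measurable_cong_sets[OF sets_hausdorff_measure refl])
  then show ?thesis unfolding surface_measure_def by (rule measurable_restrict_space1)
qed

lemma bounded_on_closure:
  fixes f :: "'a::euclidean_space \<Rightarrow> 'b::real_normed_vector"
  assumes "continuous_on UNIV f" "bounded \<Omega>"
  obtains B where "\<And>x. x \<in> closure \<Omega> \<Longrightarrow> norm (f x) \<le> B"
proof -
  have "compact (f ` closure \<Omega>)"
    using assms by (intro compact_continuous_image) (auto intro: continuous_on_subset)
  then obtain B where "\<forall>y\<in>f ` closure \<Omega>. norm y \<le> B"
    using compact_imp_bounded bounded_iff by metis
  then show ?thesis by (intro that[of B]) auto
qed

lemma L2_surface_continuous:
  fixes f :: "'a::euclidean_space \<Rightarrow> 'b::euclidean_space"
  assumes f: "continuous_on UNIV f" and \<Omega>: "bounded \<Omega>" and fin: "finite_measure (surface_measure \<Omega>)"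
  shows "L2 (surface_measure \<Omega>) f"
proof -
  interpret finite_measure "surface_measure \<Omega>" by (rule fin)
  obtain B where B: "\<And>x. x \<in> closure \<Omega> \<Longrightarrow> norm (f x) \<le> B"
    using bounded_on_closure[OF f \<Omega>] by blast
  have "integrable (surface_measure \<Omega>) (\<lambda>x. (norm (f x))\<^sup>2)"
  proof (rule integrable_const_bound)
    show "AE x in surface_measure \<Omega>. norm ((norm (f x))\<^sup>2) \<le> B\<^sup>2"
      using B by (intro AE_I2) (auto simp: surface_measure_def space_restrict_space frontier_def
          intro!: power_mono)
  qed (use borel_measurable_surface[OF f] in measurable)
  then show ?thesis using borel_measurable_surface[OF f] by (simp add: L2_def)
qed

lemma integrable_continuous_lebesgue_on:
  fixes f :: "'a::euclidean_space \<Rightarrow> real"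
  assumes f: "continuous_on UNIV f" and \<Omega>: "open \<Omega>" "bounded \<Omega>"
  shows "integrable (lebesgue_on \<Omega>) f"
proof -
  obtain B where B: "\<And>x. x \<in> closure \<Omega> \<Longrightarrow> norm (f x) \<le> B"
    using bounded_on_closure[OF f \<Omega>(2)] by blast
  have lm: "\<Omega> \<in> lmeasurable" using \<Omega> by (simp add: lmeasurable_open)
  have fm: "finite_measure (lebesgue_on \<Omega>)"
    using lm by (rule finite_measure_lebesgue_on)
  have "f \<in> borel_measurable (lebesgue_on \<Omega>)"
    using f \<Omega> by (intro continuous_imp_measurable_on_sets_lebesgue) (auto intro: continuous_on_subset)
  then show ?thesis
    using B closure_subset[of \<Omega>]
    by (intro finite_measure.integrable_const_bound[OF fm, where B = B] AE_I2) auto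
qed

lemma divergence_scaleR:
  assumes "C1 \<phi>" "C1_field F"
  shows "divergence (\<lambda>x. \<phi> x *\<^sub>R F x) x = F x \<bullet> grad \<phi> x + \<phi> x * divergence F x"
proof -
  have "divergence (\<lambda>x. \<phi> x *\<^sub>R F x) x
      = (\<Sum>b\<in>Basis. \<phi> x * (grad (\<lambda>y. F y \<bullet> b) x \<bullet> b) + (F x \<bullet> b) * (grad \<phi> x \<bullet> b))"
    using assms unfolding divergence_def inner_scaleR_left
    by (intro sum.cong refl) (auto simp: C1_mult_grad C1_field_def inner_add_left)
  then show ?thesis
    using euclidean_inner[of "F x" "grad \<phi> x"]
    by (simp add: sum.distrib divergence_def sum_distrib_left)
qed

lemma C1_field_scaleR: "C1 \<phi> \<Longrightarrow> C1_field F \<Longrightarrow> C1_field (\<lambda>x. \<phi> x *\<^sub>R F x)"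
  by (auto simp: C1_field_def intro: C1_mult)

lemma L2_lebesgue_continuous:
  fixes f :: "'a::euclidean_space \<Rightarrow> 'b::euclidean_space"
  assumes f: "continuous_on UNIV f" and \<Omega>: "open \<Omega>" "bounded \<Omega>"
  shows "L2 (lebesgue_on \<Omega>) f"
  unfolding L2_def
proof
  show "f \<in> borel_measurable (lebesgue_on \<Omega>)"
    using \<Omega> by (intro continuous_imp_measurable_on_sets_lebesgue continuous_on_subset[OF f]) auto
  show "integrable (lebesgue_on \<Omega>) (\<lambda>x. (norm (f x))\<^sup>2)"
    by (intro integrable_continuous_lebesgue_on \<Omega> continuous_intros f)
qed

lemma grad_const: "grad (\<lambda>_. c) x = 0"
  by (rule grad_eqI) simp

lemma C1_field_const: "C1_field (\<lambda>_. c)"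
  by (simp add: C1_field_def C1_def grad_const)

lemma surface_integral_test_function:
  assumes "open \<Omega>" "test_function \<Omega> \<phi>"
  shows "(LINT x|surface_measure \<Omega>. \<phi> x * f x) = 0"
proof -
  obtain K where K: "K \<subseteq> \<Omega>" "\<And>x. x \<notin> K \<Longrightarrow> \<phi> x = 0"
    using assms by (auto simp: test_function_def)
  have "(LINT x|surface_measure \<Omega>. \<phi> x * f x) = (LINT x|surface_measure \<Omega>. 0)"
    using K assms(1) by (intro Bochner_Integration.integral_cong)
      (auto simp: surface_measure_def space_restrict_space frontier_def interior_open)
  then show ?thesis by simp
qed

theorem boundary_trace_C1:
  assumes dom: "divergence_theorem_domain \<Omega> \<nu>" and V: "C1 V"
  shows "boundary_trace \<Omega> V (grad V) V"
proof -
  have \<Omega>: "open \<Omega>" "bounded \<Omega>" and fin: "finite_measure (surface_measure \<Omega>)"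
    using dom by (auto simp: divergence_theorem_domain_def)
  have gV: "continuous_on UNIV (grad V)" using V by (simp add: C1_def)
  have "weak_gradient \<Omega> V (grad V)"
    unfolding weak_gradient_def
  proof (intro allI impI ballI)
    fix \<phi> and b :: 'a assume \<phi>: "test_function \<Omega> \<phi>"
    then have C\<phi>: "C1 \<phi>" by (simp add: test_function_def)
    then have g\<phi>: "continuous_on UNIV (grad \<phi>)" by (simp add: C1_def)
    have "(LINT x|lebesgue_on \<Omega>. divergence (\<lambda>x. (\<phi> x * V x) *\<^sub>R b) x)
        = (LINT x|surface_measure \<Omega>. ((\<phi> x * V x) *\<^sub>R b) \<bullet> \<nu> x)"
      using dom C1_field_scaleR[OF C1_mult[OF C\<phi> V] C1_field_const]
      unfolding divergence_theorem_domain_def by blast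
    also have "\<dots> = 0"
      using surface_integral_test_function[OF \<Omega>(1) \<phi>, of "\<lambda>x. V x * (b \<bullet> \<nu> x)"]
      by (simp add: mult.assoc)
    also have "(\<lambda>x. divergence (\<lambda>x. (\<phi> x * V x) *\<^sub>R b) x)
        = (\<lambda>x. V x * (grad \<phi> x \<bullet> b) + (grad V x \<bullet> b) * \<phi> x)"
      by (rule ext, subst divergence_scaleR[OF C1_mult[OF C\<phi> V] C1_field_const])
        (simp add: C1_mult_grad[OF C\<phi> V] divergence_def grad_const inner_add_right inner_commute)
    also have "(LINT x|lebesgue_on \<Omega>. V x * (grad \<phi> x \<bullet> b) + (grad V x \<bullet> b) * \<phi> x)
        = (LINT x|lebesgue_on \<Omega>. V x * (grad \<phi> x \<bullet> b)) + (LINT x|lebesgue_on \<Omega>. (grad V x \<bullet> b) * \<phi> x)"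
      by (intro Bochner_Integration.integral_add integrable_continuous_lebesgue_on \<Omega>
          continuous_intros C1_continuous V C\<phi> gV g\<phi>)
    finally show "(LINT x|lebesgue_on \<Omega>. V x * (grad \<phi> x \<bullet> b))
        = - (LINT x|lebesgue_on \<Omega>. (grad V x \<bullet> b) * \<phi> x)" by simp
  qed
  then have "H1_function \<Omega> V (grad V)"
    using L2_lebesgue_continuous[OF C1_continuous[OF V] \<Omega>] L2_lebesgue_continuous[OF gV \<Omega>]
    by (simp add: H1_function_def)
  then show ?thesis
    using V L2_surface_continuous[OF C1_continuous[OF V] \<Omega>(2) fin]
    by (auto simp: boundary_trace_def intro!: exI[of _ "\<lambda>_. V"])
qed

theorem normal_trace_C1:
  assumes dom: "divergence_theorem_domain \<Omega> \<nu>" and J: "C1_field J"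
    and div0: "\<And>x. x \<in> \<Omega> \<Longrightarrow> divergence J x = 0"
  shows "normal_trace \<Omega> \<nu> J (\<lambda>x. J x \<bullet> \<nu> x)"
proof -
  have \<Omega>: "open \<Omega>" "bounded \<Omega>" and fin: "finite_measure (surface_measure \<Omega>)"
    and [measurable]: "\<nu> \<in> borel_measurable (surface_measure \<Omega>)"
    and unit: "AE x in surface_measure \<Omega>. norm (\<nu> x) = 1"
    using dom by (auto simp: divergence_theorem_domain_def outward_unit_normal_def)
  have [measurable]: "J \<in> borel_measurable (surface_measure \<Omega>)"
    by (intro borel_measurable_surface C1_field_continuous J)
  have green: "(LINT x|surface_measure \<Omega>. \<phi> x * (J x \<bullet> \<nu> x)) = (LINT x|lebesgue_on \<Omega>. J x \<bullet> grad \<phi> x)"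
    if \<phi>: "C1 \<phi>" for \<phi>
  proof -
    have "(LINT x|surface_measure \<Omega>. (\<phi> x *\<^sub>R J x) \<bullet> \<nu> x)
        = (LINT x|lebesgue_on \<Omega>. divergence (\<lambda>x. \<phi> x *\<^sub>R J x) x)"
      using dom C1_field_scaleR[OF \<phi> J] unfolding divergence_theorem_domain_def by metis
    also have "\<dots> = (LINT x|lebesgue_on \<Omega>. J x \<bullet> grad \<phi> x)"
      by (rule Bochner_Integration.integral_cong) (auto simp: divergence_scaleR[OF \<phi> J] div0)
    finally show ?thesis by simp
  qed
  have "L2 (surface_measure \<Omega>) (\<lambda>x. J x \<bullet> \<nu> x)"
    unfolding L2_def
  proof (intro conjI)
    show "integrable (surface_measure \<Omega>) (\<lambda>x. (norm (J x \<bullet> \<nu> x))\<^sup>2)"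
    proof (rule Bochner_Integration.integrable_bound)
      show "integrable (surface_measure \<Omega>) (\<lambda>x. (norm (J x))\<^sup>2)"
        using L2_surface_continuous[OF C1_field_continuous[OF J] \<Omega>(2) fin] by (simp add: L2_def)
      show "AE x in surface_measure \<Omega>. norm ((norm (J x \<bullet> \<nu> x))\<^sup>2) \<le> norm ((norm (J x))\<^sup>2)"
        using unit
      proof eventually_elim
        case (elim x)
        then show ?case using Cauchy_Schwarz_ineq2[of "J x" "\<nu> x"] using abs_le_square_iff[of "J x \<bullet> \<nu> x" "norm (J x)"] by simp
      qed
    qed measurable
  qed measurable
  moreover have "weakly_divergence_free \<Omega> J"
    unfolding weakly_divergence_free_def
  proof (intro allI impI)
    fix \<phi> assume \<phi>: "test_function \<Omega> \<phi>"
    then have "C1 \<phi>" by (simp add: test_function_def)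
    then show "(LINT x|lebesgue_on \<Omega>. J x \<bullet> grad \<phi> x) = 0"
      using green surface_integral_test_function[OF \<Omega>(1) \<phi>, of "\<lambda>x. J x \<bullet> \<nu> x"] by simp
  qed
  moreover have "L2 (lebesgue_on \<Omega>) J"
    by (rule L2_lebesgue_continuous[OF C1_field_continuous[OF J] \<Omega>])
  moreover have "(LINT x|lebesgue_on \<Omega>. (divergence J x)\<^sup>2) = (LINT x|lebesgue_on \<Omega>. 0)"
    by (rule Bochner_Integration.integral_cong) (auto simp: div0)
  ultimately show ?thesis
    unfolding normal_trace_def using J by (auto intro!: exI[of _ "\<lambda>_. J"])
qed

end

(* Green's identity for functions and fields that are C^1 up to the boundary is the divergence
   theorem applied to phi F. Every integral in it is an L^2 pairing, hence continuous under the
   convergences that define the traces; in the limit the divergence term drops out and the boundary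
   formula remains. The bound is the pointwise estimate sigma |E|^2 <= sigma c^2 in each phase. *)

theory Submission
  imports Defs
begin

text \<open>The codomains may differ because a scalar, the normal component of a field, is later
  compared with the field itself.\<close>

lemma L2_dominated:
  fixes f :: "'a \<Rightarrow> 'b::euclidean_space" and g :: "'a \<Rightarrow> 'c::euclidean_space"
  assumes "L2 M f" and [measurable]: "g \<in> borel_measurable M"
    and "AE x in M. norm (g x) \<le> norm (f x)"
  shows "L2 M g"
  unfolding L2_def
proof
  show "integrable M (\<lambda>x. (norm (g x))\<^sup>2)"
  proof (rule Bochner_Integration.integrable_bound)
    show "integrable M (\<lambda>x. (norm (f x))\<^sup>2)" using assms(1) by (simp add: L2_def)
    show "AE x in M. norm ((norm (g x))\<^sup>2) \<le> norm ((norm (f x))\<^sup>2)"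
      using assms(3) by eventually_elim (simp add: power_mono)
  qed measurable
qed fact

lemma L2_diff:
  fixes f g :: "'a \<Rightarrow> 'b::euclidean_space"
  assumes "L2 M f" "L2 M g"
  shows "L2 M (\<lambda>x. f x - g x)"
proof -
  have [measurable]: "f \<in> borel_measurable M" "g \<in> borel_measurable M"
    using assms by (auto simp: L2_def)
  \<comment> \<open>The parallelogram identity: the two sides differ by exactly
    \<open>(norm (a + b))\<^sup>2\<close>.\<close>
  have le: "(norm (a - b))\<^sup>2 \<le> 2 * (norm a)\<^sup>2 + 2 * (norm b)\<^sup>2" for a b :: 'b
    using zero_le_power2[of "norm (a + b)"]
    by (simp add: power2_norm_eq_inner inner_add inner_diff inner_commute)
  have "integrable M (\<lambda>x. (norm (f x - g x))\<^sup>2)"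
  proof (rule Bochner_Integration.integrable_bound)
    show "integrable M (\<lambda>x. 2 * (norm (f x))\<^sup>2 + 2 * (norm (g x))\<^sup>2)"
      using assms by (auto simp: L2_def)
  qed (use le in auto)
  then show ?thesis by (simp add: L2_def)
qed

lemma L2_inner_integrable:
  fixes f g :: "'a \<Rightarrow> 'b::euclidean_space"
  assumes "L2 M f" "L2 M g"
  shows "integrable M (\<lambda>x. f x \<bullet> g x)"
proof (rule Bochner_Integration.integrable_bound)
  have [measurable]: "f \<in> borel_measurable M" "g \<in> borel_measurable M"
    using assms by (auto simp: L2_def)
  show "(\<lambda>x. f x \<bullet> g x) \<in> borel_measurable M" by measurable
  show "integrable M (\<lambda>x. (norm (f x))\<^sup>2 + (norm (g x))\<^sup>2)"
    using assms by (auto simp: L2_def)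
  \<comment> \<open>Expanding \<open>(norm a - norm b)\<^sup>2 \<ge> 0\<close> bounds twice
    \<open>norm a * norm b\<close>; since that product is nonnegative, the product itself is bounded
    too.\<close>
  have "\<bar>a \<bullet> b\<bar> \<le> (norm a)\<^sup>2 + (norm b)\<^sup>2" for a b :: 'b
    using Cauchy_Schwarz_ineq2[of a b] zero_le_power2[of "norm a - norm b"]
      mult_nonneg_nonneg[OF norm_ge_zero[of a] norm_ge_zero[of b]]
    unfolding power2_diff by linarith
  then show "AE x in M. norm (f x \<bullet> g x) \<le> norm ((norm (f x))\<^sup>2 + (norm (g x))\<^sup>2)"
    by simp
qed

text \<open>The inequality for nonnegative extended integrals is applied to the two norms. Square
  integrability makes every integral finite, so the result carries over to Bochner
  integrals.\<close>

lemma L2_Cauchy_Schwarz: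
  fixes f g :: "'a \<Rightarrow> 'b::euclidean_space"
  assumes f: "L2 M f" and g: "L2 M g"
  shows "\<bar>LINT x|M. f x \<bullet> g x\<bar> \<le> sqrt ((LINT x|M. (norm (f x))\<^sup>2) * (LINT x|M. (norm (g x))\<^sup>2))"
proof -
  have [measurable]: "f \<in> borel_measurable M" "g \<in> borel_measurable M"
    using assms by (auto simp: L2_def)
  have norms: "L2 M (\<lambda>x. norm (f x))" "L2 M (\<lambda>x. norm (g x))"
    using f g by (auto simp: L2_def)
  \<comment> \<open>On the real-valued norms the inner product is multiplication.\<close>
  have fg: "integrable M (\<lambda>x. norm (f x) * norm (g x))"
    using L2_inner_integrable[OF norms] by simp
  have "ennreal ((LINT x|M. norm (f x) * norm (g x))\<^sup>2)
      = (\<integral>\<^sup>+x. ennreal (norm (f x)) * ennreal (norm (g x)) \<partial>M)\<^sup>2"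
    by (simp add: nn_integral_eq_integral[OF fg] ennreal_mult[symmetric] ennreal_power)
  also have "\<dots> \<le> (\<integral>\<^sup>+x. (ennreal (norm (f x)))\<^sup>2 \<partial>M) * (\<integral>\<^sup>+x. (ennreal (norm (g x)))\<^sup>2 \<partial>M)"
    by (rule Cauchy_Schwarz_nn_integral) measurable
  also have "\<dots> = ennreal ((LINT x|M. (norm (f x))\<^sup>2) * (LINT x|M. (norm (g x))\<^sup>2))"
    using f g by (simp add: L2_def ennreal_power nn_integral_eq_integral ennreal_mult)
  finally have "(LINT x|M. norm (f x) * norm (g x))\<^sup>2
      \<le> (LINT x|M. (norm (f x))\<^sup>2) * (LINT x|M. (norm (g x))\<^sup>2)"
    by (subst (asm) ennreal_le_iff) auto
  then have "(LINT x|M. norm (f x) * norm (g x))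
      \<le> sqrt ((LINT x|M. (norm (f x))\<^sup>2) * (LINT x|M. (norm (g x))\<^sup>2))"
    by (rule real_le_rsqrt)
  moreover have "\<bar>LINT x|M. f x \<bullet> g x\<bar> \<le> (LINT x|M. \<bar>f x \<bullet> g x\<bar>)"
    by (rule integral_abs_bound)
  moreover have "(LINT x|M. \<bar>f x \<bullet> g x\<bar>) \<le> (LINT x|M. norm (f x) * norm (g x))"
    using L2_inner_integrable[OF f g] fg by (intro integral_mono) (auto simp: Cauchy_Schwarz_ineq2)
  ultimately show ?thesis by linarith
qed

text \<open>Expanding both factors around their limits leaves three error terms, each with at least
  one factor that tends to zero in \<open>L2\<close>; Cauchy-Schwarz makes each of them
  vanish.\<close>

lemma L2_inner_tendsto:
  fixes f g :: "'a \<Rightarrow> 'b::euclidean_space"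
  assumes f: "L2 M f" and g: "L2 M g" and F: "\<And>k. L2 M (F k)" and G: "\<And>k. L2 M (G k)"
    and Ff: "(\<lambda>k. LINT x|M. (norm (F k x - f x))\<^sup>2) \<longlonglongrightarrow> 0"
    and Gg: "(\<lambda>k. LINT x|M. (norm (G k x - g x))\<^sup>2) \<longlonglongrightarrow> 0"
  shows "(\<lambda>k. LINT x|M. F k x \<bullet> G k x) \<longlonglongrightarrow> (LINT x|M. f x \<bullet> g x)"
proof -
  \<comment> \<open>Only the product of the squared norms has to tend to zero, so one factor may
    stay fixed, as in the two mixed error terms.\<close>
  have small: "(\<lambda>k. LINT x|M. a k x \<bullet> b k x) \<longlonglongrightarrow> 0"
    if "\<And>k. L2 M (a k)" "\<And>k. L2 M (b k)"
      and "(\<lambda>k. (LINT x|M. (norm (a k x))\<^sup>2) * (LINT x|M. (norm (b k x))\<^sup>2)) \<longlonglongrightarrow> 0"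
    for a b :: "nat \<Rightarrow> 'a \<Rightarrow> 'b"
  proof (rule Lim_null_comparison)
    show "\<forall>\<^sub>F k in sequentially. norm (LINT x|M. a k x \<bullet> b k x)
        \<le> sqrt ((LINT x|M. (norm (a k x))\<^sup>2) * (LINT x|M. (norm (b k x))\<^sup>2))"
      using L2_Cauchy_Schwarz[OF that(1,2)] by simp
    show "(\<lambda>k. sqrt ((LINT x|M. (norm (a k x))\<^sup>2) * (LINT x|M. (norm (b k x))\<^sup>2))) \<longlonglongrightarrow> 0"
      using tendsto_real_sqrt[OF that(3)] by simp
  qed
  have dF: "L2 M (\<lambda>x. F k x - f x)" and dG: "L2 M (\<lambda>x. G k x - g x)" for k
    using f g F G by (auto intro: L2_diff)
  have split: "(LINT x|M. F k x \<bullet> G k x) = (LINT x|M. (F k x - f x) \<bullet> (G k x - g x))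
      + (LINT x|M. (F k x - f x) \<bullet> g x) + (LINT x|M. f x \<bullet> (G k x - g x)) + (LINT x|M. f x \<bullet> g x)" for k
  proof -
    have "(LINT x|M. F k x \<bullet> G k x) = (LINT x|M. (F k x - f x) \<bullet> (G k x - g x)
        + (F k x - f x) \<bullet> g x + f x \<bullet> (G k x - g x) + f x \<bullet> g x)"
      by (intro Bochner_Integration.integral_cong refl) (simp add: inner_diff)
    also have "\<dots> = (LINT x|M. (F k x - f x) \<bullet> (G k x - g x))
      + (LINT x|M. (F k x - f x) \<bullet> g x) + (LINT x|M. f x \<bullet> (G k x - g x)) + (LINT x|M. f x \<bullet> g x)"
      by (simp add: L2_inner_integrable[OF dF dG] L2_inner_integrable[OF dF g]
          L2_inner_integrable[OF f dG] L2_inner_integrable[OF f g]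
          del: inner_diff_left inner_diff_right)
    finally show ?thesis .
  qed
  have "(\<lambda>k. (LINT x|M. (F k x - f x) \<bullet> (G k x - g x))
      + (LINT x|M. (F k x - f x) \<bullet> g x) + (LINT x|M. f x \<bullet> (G k x - g x)) + (LINT x|M. f x \<bullet> g x))
      \<longlonglongrightarrow> 0 + 0 + 0 + (LINT x|M. f x \<bullet> g x)"
  proof (intro tendsto_add small tendsto_const dF dG f g)
    show "(\<lambda>k. (LINT x|M. (norm (F k x - f x))\<^sup>2) * (LINT x|M. (norm (G k x - g x))\<^sup>2)) \<longlonglongrightarrow> 0"
      using tendsto_mult[OF Ff Gg] by simp
    show "(\<lambda>k. (LINT x|M. (norm (F k x - f x))\<^sup>2) * (LINT x|M. (norm (g x))\<^sup>2)) \<longlonglongrightarrow> 0"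
      using tendsto_mult_right[OF Ff] by simp
    show "(\<lambda>k. (LINT x|M. (norm (f x))\<^sup>2) * (LINT x|M. (norm (G k x - g x))\<^sup>2)) \<longlonglongrightarrow> 0"
      using tendsto_mult_left[OF Gg] by simp
  qed
  then show ?thesis by (simp add: split)
qed

lemma continuous_on_divergence: "C1_field F \<Longrightarrow> continuous_on UNIV (divergence F)"
  unfolding divergence_def[abs_def] C1_field_def C1_def by (intro continuous_intros) auto

text \<open>The normal \<open>\<nu>\<close> is merely measurable, so
  \<open>F x \<bullet> \<nu> x\<close> need not be continuous. As \<open>\<nu>\<close> has unit
  length almost everywhere, the product is dominated by \<open>F\<close>, which is continuous on a
  bounded boundary of finite surface measure.\<close>

lemma L2_normal_component:
  assumes "divergence_theorem_domain \<Omega> \<nu>" "C1_field F"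
  shows "L2 (surface_measure \<Omega>) (\<lambda>x. F x \<bullet> \<nu> x)"
proof (rule L2_dominated)
  have F: "continuous_on UNIV F" using assms(2) by (rule C1_field_continuous)
  show "L2 (surface_measure \<Omega>) F"
    using assms(1) by (intro L2_surface_continuous F) (auto simp: divergence_theorem_domain_def)
  have [measurable]: "F \<in> borel_measurable (surface_measure \<Omega>)"
      "\<nu> \<in> borel_measurable (surface_measure \<Omega>)"
    using assms(1) F by (auto simp: divergence_theorem_domain_def intro: borel_measurable_surface)
  show "(\<lambda>x. F x \<bullet> \<nu> x) \<in> borel_measurable (surface_measure \<Omega>)" by measurable
  have "AE x in surface_measure \<Omega>. norm (\<nu> x) = 1"
    using assms(1) by (auto simp: divergence_theorem_domain_def outward_unit_normal_def)
  then show "AE x in surface_measure \<Omega>. norm (F x \<bullet> \<nu> x) \<le> norm (F x)"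
  proof eventually_elim
    case (elim x)
    then show ?case using Cauchy_Schwarz_ineq2[of "F x" "\<nu> x"] by simp
  qed
qed

text \<open>Weak freedom from divergence is tested only with functions supported inside
  \<open>\<Omega>\<close> and says nothing about the boundary. The boundary term comes instead from
  the approximating sequences that define the two traces.\<close>

theorem Green_formula_traces:
  assumes dom: "divergence_theorem_domain \<Omega> \<nu>"
    and u: "boundary_trace \<Omega> V G u" and g: "normal_trace \<Omega> \<nu> J g"
  shows "(LINT x|lebesgue_on \<Omega>. J x \<bullet> G x) = (LINT x|surface_measure \<Omega>. u x * g x)"
proof -
  let ?L = "lebesgue_on \<Omega>" and ?S = "surface_measure \<Omega>"
  have \<Omega>: "open \<Omega>" "bounded \<Omega>" and fin: "finite_measure ?S"
    using dom by (auto simp: divergence_theorem_domain_def)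
  obtain \<phi> where \<phi>: "\<And>k. C1 (\<phi> k)"
    and \<phi>V: "(\<lambda>k. LINT x|?L. (\<phi> k x - V x)\<^sup>2) \<longlonglongrightarrow> 0"
    and \<phi>G: "(\<lambda>k. LINT x|?L. (norm (grad (\<phi> k) x - G x))\<^sup>2) \<longlonglongrightarrow> 0"
    and \<phi>u: "(\<lambda>k. LINT x|?S. (\<phi> k x - u x)\<^sup>2) \<longlonglongrightarrow> 0"
    using u by (auto simp: boundary_trace_def)
  obtain F where F: "\<And>k. C1_field (F k)"
    and FJ: "(\<lambda>k. LINT x|?L. (norm (F k x - J x))\<^sup>2) \<longlonglongrightarrow> 0"
    and divF: "(\<lambda>k. LINT x|?L. (divergence (F k) x)\<^sup>2) \<longlonglongrightarrow> 0"
    and Fg: "(\<lambda>k. LINT x|?S. (F k x \<bullet> \<nu> x - g x)\<^sup>2) \<longlonglongrightarrow> 0"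
    using g by (auto simp: normal_trace_def)
  have VG: "L2 ?L V" "L2 ?L G" "L2 ?S u" and Jg: "L2 ?L J" "L2 ?S g"
    using u g by (auto simp: boundary_trace_def H1_function_def normal_trace_def)
  \<comment> \<open>The zero function is the \<open>L2\<close> limit of the divergences of
    \<open>F k\<close>.\<close>
  have zero: "L2 ?L (\<lambda>_. 0::real)" by (simp add: L2_def)
  have grad\<phi>: "L2 ?L (grad (\<phi> k))" for k
    using \<phi> by (intro L2_lebesgue_continuous \<Omega>) (simp add: C1_def)
  have \<phi>L: "L2 ?L (\<phi> k)" and \<phi>S: "L2 ?S (\<phi> k)" for k
    using \<phi> by (auto intro!: L2_lebesgue_continuous L2_surface_continuous \<Omega> fin C1_continuous)
  have FL: "L2 ?L (F k)" and dF: "L2 ?L (divergence (F k))" for k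
    using F by (auto intro!: L2_lebesgue_continuous \<Omega> C1_field_continuous continuous_on_divergence)
  note FS = L2_normal_component[OF dom F]
  \<comment> \<open>Products of reals are written as inner products so that
    \<open>L2_inner_tendsto\<close> applies to the scalar pairings as well as to the vector
    one.\<close>
  have green: "(LINT x|?L. F k x \<bullet> grad (\<phi> k) x) + (LINT x|?L. \<phi> k x \<bullet> divergence (F k) x)
      = (LINT x|?S. \<phi> k x \<bullet> (F k x \<bullet> \<nu> x))" for k
  proof -
    have "(LINT x|?L. F k x \<bullet> grad (\<phi> k) x) + (LINT x|?L. \<phi> k x \<bullet> divergence (F k) x)
        = (LINT x|?L. F k x \<bullet> grad (\<phi> k) x + \<phi> k x \<bullet> divergence (F k) x)"
      by (rule Bochner_Integration.integral_add[symmetric])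
        (rule L2_inner_integrable[OF FL grad\<phi>], rule L2_inner_integrable[OF \<phi>L dF])
    also have "\<dots> = (LINT x|?L. divergence (\<lambda>x. \<phi> k x *\<^sub>R F k x) x)"
      by (simp add: divergence_scaleR[OF \<phi> F])
    also have "\<dots> = (LINT x|?S. (\<phi> k x *\<^sub>R F k x) \<bullet> \<nu> x)"
      using dom C1_field_scaleR[OF \<phi> F] unfolding divergence_theorem_domain_def by blast
    finally show ?thesis by simp
  qed
  \<comment> \<open>The approximating fields need not be divergence-free; their divergences tend to
    zero while \<open>\<phi> k\<close> tends to \<open>V\<close>, so that pairing contributes
    nothing in the limit.\<close>
  have "(\<lambda>k. (LINT x|?L. F k x \<bullet> grad (\<phi> k) x) + (LINT x|?L. \<phi> k x \<bullet> divergence (F k) x))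
      \<longlonglongrightarrow> (LINT x|?L. J x \<bullet> G x) + (LINT x|?L. V x \<bullet> 0)"
    using \<phi>V divF
    by (intro tendsto_add L2_inner_tendsto FL grad\<phi> \<phi>L dF VG Jg FJ \<phi>G zero) auto
  moreover have "(\<lambda>k. LINT x|?S. \<phi> k x \<bullet> (F k x \<bullet> \<nu> x)) \<longlonglongrightarrow> (LINT x|?S. u x \<bullet> g x)"
    using \<phi>u Fg by (intro L2_inner_tendsto \<phi>S FS VG Jg) auto
  ultimately show ?thesis
    unfolding green by (auto dest: LIMSEQ_unique)
qed

lemma dissipation_bound:
  fixes \<Omega> :: "'a::euclidean_space set"
  assumes \<Omega>: "open \<Omega>" "bounded \<Omega>" and body: "two_phase_body \<Omega> \<Omega>1 \<Omega>2"
    and \<sigma>: "\<sigma>1 \<ge> 0" "\<sigma>2 \<ge> 0"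
    and sol: "conductivity_solution \<Omega> (two_phase_conductivity \<Omega>1 \<Omega>2 \<sigma>1 \<sigma>2) V E J"
    and nb: "not_broken_down \<Omega>1 c1 E" "not_broken_down \<Omega>2 c2 E"
  shows "(LINT x|lebesgue_on \<Omega>. J x \<bullet> E x)
    \<le> \<sigma>1 * c1\<^sup>2 * measure lebesgue \<Omega>1 + \<sigma>2 * c2\<^sup>2 * measure lebesgue \<Omega>2"
proof -
  let ?L = "lebesgue_on \<Omega>"
  have \<Omega>L: "\<Omega> \<in> sets lebesgue" "\<Omega> \<in> lmeasurable" using \<Omega> by (auto simp: lmeasurable_open)
  interpret finite_measure ?L by (rule finite_measure_lebesgue_on[OF \<Omega>L(2)])
  have ph: "\<Omega>1 \<in> sets lebesgue" "\<Omega>2 \<in> sets lebesgue" "\<Omega>1 \<subseteq> \<Omega>" "\<Omega>2 \<subseteq> \<Omega>"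
    using body by (auto simp: two_phase_body_def)
  then have phL: "\<Omega>1 \<in> sets ?L" "\<Omega>2 \<in> sets ?L"
    using \<Omega>L by (auto simp: sets_restrict_space_iff)
  have "L2 ?L J" and "L2 ?L (\<lambda>x. - E x)" and JE: "AE x in ?L. J x = two_phase_conductivity \<Omega>1 \<Omega>2 \<sigma>1 \<sigma>2 x *\<^sub>R E x"
    using sol by (auto simp: conductivity_solution_def H1_function_def)
  \<comment> \<open>The solution supplies square integrability of the gradient \<open>- E\<close>;
    the sign does not affect integrability.\<close>
  from L2_inner_integrable[OF this(1,2)] have int: "integrable ?L (\<lambda>x. J x \<bullet> E x)" by simp
  \<comment> \<open>A statement almost everywhere on one phase becomes an implication almost
    everywhere on \<open>\<Omega>\<close>, so that both phases and the constitutive law can be used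
    at the same point.\<close>
  have phase: "AE x in ?L. x \<in> A \<longrightarrow> norm (E x) < c"
    if "not_broken_down A c E" "A \<in> sets lebesgue" for A c
    using that \<Omega>L by (auto simp: not_broken_down_def AE_restrict_space_iff)
  have int1: "integrable ?L (indicator \<Omega>1 :: 'a \<Rightarrow> real)" "integrable ?L (indicator \<Omega>2 :: 'a \<Rightarrow> real)"
    using phL by (auto simp: less_top[symmetric])
  have "(LINT x|?L. J x \<bullet> E x)
      \<le> (LINT x|?L. \<sigma>1 * c1\<^sup>2 * indicator \<Omega>1 x + \<sigma>2 * c2\<^sup>2 * indicator \<Omega>2 x)"
  proof (rule integral_mono_AE[OF int])
    show "integrable ?L (\<lambda>x. \<sigma>1 * c1\<^sup>2 * indicator \<Omega>1 x + \<sigma>2 * c2\<^sup>2 * indicator \<Omega>2 x)"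
      using int1 by (intro Bochner_Integration.integrable_add integrable_mult_right) auto
    show "AE x in ?L. J x \<bullet> E x \<le> \<sigma>1 * c1\<^sup>2 * indicator \<Omega>1 x + \<sigma>2 * c2\<^sup>2 * indicator \<Omega>2 x"
      using JE phase[OF nb(1) ph(1)] phase[OF nb(2) ph(2)]
    proof eventually_elim
      case (elim x)
      \<comment> \<open>Off \<open>A\<close> both sides vanish; on \<open>A\<close> squaring
        preserves the inequality because norms are nonnegative.\<close>
      have le: "s * indicator A x * (norm (E x))\<^sup>2 \<le> s * c\<^sup>2 * indicator A x"
        if "s \<ge> 0" "x \<in> A \<longrightarrow> norm (E x) < c" for s c :: real and A
        using that by (auto simp: indicator_def intro!: mult_left_mono power_mono)
      show ?case
        using le[OF \<sigma>(1) elim(2)] le[OF \<sigma>(2) elim(3)]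
        by (simp add: elim(1) two_phase_conductivity_def power2_norm_eq_inner algebra_simps)
    qed
  qed
  also have "\<dots> = \<sigma>1 * c1\<^sup>2 * measure ?L \<Omega>1 + \<sigma>2 * c2\<^sup>2 * measure ?L \<Omega>2"
    using int1 ph by (subst Bochner_Integration.integral_add) (auto simp: Int_absorb2)
  also have "measure ?L \<Omega>1 = measure lebesgue \<Omega>1"
    using \<Omega>L ph by (intro measure_restrict_space) auto
  also have "measure ?L \<Omega>2 = measure lebesgue \<Omega>2"
    using \<Omega>L ph by (intro measure_restrict_space) auto
  finally show ?thesis .
qed

text \<open>The boundary formula is quantified over all traces \<open>u\<close> and
  \<open>g\<close>, and their existence is not asserted. The bound is a separate conjunct and refers
  to no boundary data.\<close>

theorem mainTheorem4:
  fixes \<Omega> \<Omega>1 \<Omega>2 :: "(real ^ 'n::finite) set"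
    and \<nu> :: "real ^ 'n \<Rightarrow> real ^ 'n"
    and \<sigma>1 \<sigma>2 c1 c2 :: real
    and V :: "real ^ 'n \<Rightarrow> real"
    and E J :: "real ^ 'n \<Rightarrow> real ^ 'n"
  assumes "CARD('n) = 2 \<or> CARD('n) = 3"
    and "divergence_theorem_domain \<Omega> \<nu>"
    and "two_phase_body \<Omega> \<Omega>1 \<Omega>2"
    and "\<sigma>1 \<ge> 0" and "\<sigma>2 \<ge> 0" and "c1 > 0" and "c2 > 0"
    and "conductivity_solution \<Omega> (two_phase_conductivity \<Omega>1 \<Omega>2 \<sigma>1 \<sigma>2) V E J"
    and "not_broken_down \<Omega>1 c1 E" and "not_broken_down \<Omega>2 c2 E"
  shows "(\<forall>u g. boundary_trace \<Omega> V (\<lambda>x. - E x) u \<longrightarrow> normal_trace \<Omega> \<nu> J g \<longrightarrow>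
            volume_average \<Omega> (\<lambda>x. J x \<bullet> E x)
              = - (1 / measure lebesgue \<Omega>) * (LINT x|surface_measure \<Omega>. u x * g x))
       \<and> volume_average \<Omega> (\<lambda>x. J x \<bullet> E x)
           \<le> \<sigma>1 * c1\<^sup>2 * volume_fraction \<Omega> \<Omega>1 + \<sigma>2 * c2\<^sup>2 * volume_fraction \<Omega> \<Omega>2"
proof (intro conjI allI impI)
  fix u g assume "boundary_trace \<Omega> V (\<lambda>x. - E x) u" "normal_trace \<Omega> \<nu> J g"
  \<comment> \<open>Here \<open>G\<close> is \<open>- E\<close>, which produces the minus sign in
    front of the boundary integral.\<close>
  from Green_formula_traces[OF assms(2) this, symmetric]
  show "volume_average \<Omega> (\<lambda>x. J x \<bullet> E x)
      = - (1 / measure lebesgue \<Omega>) * (LINT x|surface_measure \<Omega>. u x * g x)"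
    by (simp add: volume_average_def flip: minus_divide_left)
next
  have "open \<Omega>" "bounded \<Omega>"
    using assms(2) by (auto simp: divergence_theorem_domain_def)
  from dissipation_bound[OF this assms(3,4,5,8,9,10)]
  have "volume_average \<Omega> (\<lambda>x. J x \<bullet> E x)
      \<le> 1 / measure lebesgue \<Omega> * (\<sigma>1 * c1\<^sup>2 * measure lebesgue \<Omega>1 + \<sigma>2 * c2\<^sup>2 * measure lebesgue \<Omega>2)"
    unfolding volume_average_def by (rule mult_left_mono) simp
  then show "volume_average \<Omega> (\<lambda>x. J x \<bullet> E x)
      \<le> \<sigma>1 * c1\<^sup>2 * volume_fraction \<Omega> \<Omega>1 + \<sigma>2 * c2\<^sup>2 * volume_fraction \<Omega> \<Omega>2"
    by (simp add: volume_fraction_def add_divide_distrib)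
qed

end
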